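(* Let $A$ be an algebra with a fixed basis and let $G_R(A)$ be its action to the right digraph. If $G_R(A)$ has no oriented cycles, then the lower central series of $A$ converges to $\{0\}$, i.e. $A^m=\{0\}$ for some $m$. In particular, if $A$ is a Leibniz algebra, then $A$ is nilpotent.
   Context: $\mathbb{F}$ is an algebraically closed field of characteristic zero; an algebra is a finite-dimensional $\mathbb{F}$-vector space $A$ with a bilinear product $*$. For a basis $\{x_1,\dots,x_n\}$ write $x_i*x_j=\sum_l c_{ij}^l x_l$; $G_R(A)$ has vertices $x_1,\dots,x_n$ and an arrow $x_i\to x_l$ iff $c_{ij}^l\ne0$ for some $j$ (loops allowed). An oriented cycle is a closed directed walk (a loop counts as an oriented cycle of length 1). The lower central series is $A^1=A$, $A^{k+1}=A^k*A$, where $U*V$ denotes the subspace spanned by all $u*v$, $u\in U$, $v\in V$. A Leibniz algebra is one satisfying $(x*y)*z-(x*z)*y-x*(y*z)=0$ for all $x,y,z$; it is nilpotent if $A^m=0$ for some $m$. *)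

theory Defs
  imports
    "HOL-Computational_Algebra.Polynomial"
    "Graph_Theory.Arc_Walk"
begin

locale nonassoc_algebra =
  vector_space scale
  for scale :: "'f::{alg_closed_field,field_char_0} \<Rightarrow> 'v::ab_group_add \<Rightarrow> 'v" (infixr \<open>*s\<close> 75) +
  fixes mul :: "'v \<Rightarrow> 'v \<Rightarrow> 'v" (infixl \<open>\<star>\<close> 70)
  assumes linear_mul_right: "Vector_Spaces.linear scale scale (\<lambda>y. x \<star> y)"
    and linear_mul_left: "Vector_Spaces.linear scale scale (\<lambda>x. x \<star> y)"
begin

definition subspace_mul :: "'v set \<Rightarrow> 'v set \<Rightarrow> 'v set" where
  "subspace_mul U V = local.span {u \<star> v | u v. u \<in> U \<and> v \<in> V}"

text \<open>The series is indexed from 1; the value at 0 is a dummy (the whole algebra).\<close>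

fun lower_central_series :: "nat \<Rightarrow> 'v set" where
  "lower_central_series 0 = UNIV"
| "lower_central_series (Suc 0) = UNIV"
| "lower_central_series (Suc (Suc k)) = subspace_mul (lower_central_series (Suc k)) UNIV"

definition nilpotent :: bool where
  "nilpotent \<longleftrightarrow> (\<exists>m\<ge>1. lower_central_series m = {0})"

text \<open>The convention is that of right Leibniz algebras: right multiplications are derivations.\<close>

definition leibniz :: bool where
  "leibniz \<longleftrightarrow> (\<forall>x y z. (x \<star> y) \<star> z - (x \<star> z) \<star> y - x \<star> (y \<star> z) = 0)"

end

text \<open>The basis is the set \<open>B\<close> of its (pairwise distinct) elements.\<close>

locale nonassoc_algebra_with_basis =
  nonassoc_algebra scale mul + finite_dimensional_vector_space scale B
  for scale :: "'f::{alg_closed_field,field_char_0} \<Rightarrow> 'v::ab_group_add \<Rightarrow> 'v" (infixr \<open>*s\<close> 75)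
    and mul :: "'v \<Rightarrow> 'v \<Rightarrow> 'v" (infixl \<open>\<star>\<close> 70)
    and B :: "'v set"
begin

definition structure_const :: "'v \<Rightarrow> 'v \<Rightarrow> 'v \<Rightarrow> 'f" where
  "structure_const x y z = local.representation B (x \<star> y) z"

lemma mul_eq_sum_structure_const:
  "x \<star> y = (\<Sum>z\<in>B. structure_const x y z *s z)"
  unfolding structure_const_def
  using sum_representation_eq[OF independent_Basis _ finite_Basis order_refl] span_Basis by simp

definition right_action_digraph :: "('v, 'v \<times> 'v) pre_digraph" where
  "right_action_digraph =
    \<lparr> verts = B,
      arcs = {(x, z). x \<in> B \<and> z \<in> B \<and> (\<exists>y\<in>B. structure_const x y z \<noteq> 0)},
      tail = fst,
      head = snd \<rparr>"

lemma fin_digraph_right_action_digraph: "fin_digraph right_action_digraph"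
proof
  have "arcs right_action_digraph \<subseteq> B \<times> B"
    by (auto simp: right_action_digraph_def)
  then show "finite (arcs right_action_digraph)"
    using finite_Basis finite_subset by blast
qed (auto simp: right_action_digraph_def finite_Basis)

end

end

(* Let R be the arc relation on the basis B. Multiplying on the right by an arbitrary element
   moves the span of a set D of basis vectors into the span of the set R `` D of out-neighbours,
   so A^(k+1) lies in the span of (R ^^ k) `` B, the ends of walks of length k. A finite acyclic
   digraph has no walks of large length. *)

theory Submission
  imports Defs
begin

text \<open>Well-foundedness gives a nonempty \<open>D\<close> an element without predecessor in
  \<open>D\<close>. It drops out of the image of \<open>D\<close>, so a closed set strictly shrinks
  with each step; finiteness forces the images down to the empty set.\<close>

lemma wf_relpow_Image_empty:
  assumes "wf R" "finite D" "R `` D \<subseteq> D"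
  shows "\<exists>m. (R ^^ m) `` D = {}"
  using assms(2,3)
proof (induction D rule: finite_psubset_induct)
  case (psubset D)
  show ?case
  proof (cases "D = {}")
    case False
    then obtain z where "z \<in> D" "\<And>y. (y, z) \<in> R \<Longrightarrow> y \<notin> D"
      using wfE_min'[OF \<open>wf R\<close>] by metis
    then have "R `` D \<subset> D"
      using psubset.prems by blast
    moreover have "R `` (R `` D) \<subseteq> R `` D"
      using psubset.prems by (rule Image_mono[OF subset_refl])
    ultimately obtain m where "(R ^^ m) `` (R `` D) = {}"
      by (rule psubset.IH[THEN exE])
    \<comment> \<open>The induction peels off the first step of a walk, \<open>relpow\<close> the
      last one; \<open>relpow_commute\<close> reconciles the two.\<close>
    then have "(R ^^ Suc m) `` D = {}"
      by (metis relcomp_Image relpow.simps(2) relpow_commute)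
    then show ?thesis ..
  qed auto
qed

text \<open>A pair \<open>(x, x)\<close> in the transitive closure comes from a nonempty walk from
  \<open>x\<close> to itself, that is, a closed walk; a loop is the case of length 1.\<close>

lemma (in wf_digraph) acyclic_arcs_ends:
  assumes "\<nexists>p. closed_w p"
  shows "acyclic (arcs_ends G)"
  using assms by (auto simp: acyclic_def closed_w_def reachable1_awalk)

lemma (in nonassoc_algebra) zero_in_lower_central_series: "0 \<in> lower_central_series k"
  by (induction k rule: lower_central_series.induct) (auto simp: subspace_mul_def span_zero)

context nonassoc_algebra_with_basis
begin

lemma arcs_ends_right_action_digraph:
  "arcs_ends right_action_digraph =
    {(x, z). x \<in> B \<and> z \<in> B \<and> (\<exists>y\<in>B. structure_const x y z \<noteq> 0)}"
  by (auto simp: arcs_ends_def arc_to_ends_def right_action_digraph_def image_iff)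

text \<open>By linearity in each factor it suffices to multiply \<open>x\<close> in \<open>D\<close>
  by a basis vector \<open>y\<close>. The basis vectors occurring in that product with nonzero
  coefficient are, by the definition of the digraph, out-neighbours of \<open>x\<close>.\<close>

lemma mul_in_span_out_neighbours:
  assumes "D \<subseteq> B" "u \<in> span D"
  shows "u \<star> v \<in> span (arcs_ends right_action_digraph `` D)"
proof -
  let ?S = "span (arcs_ends right_action_digraph `` D)"
  have basis: "x \<star> y \<in> ?S" if "x \<in> D" "y \<in> B" for x y
    unfolding mul_eq_sum_structure_const[of x y]
  proof (rule span_sum)
    fix z assume "z \<in> B"
    show "structure_const x y z *s z \<in> ?S"
    proof (cases "structure_const x y z = 0")
      case False
      then have "z \<in> arcs_ends right_action_digraph `` D"
        using that \<open>z \<in> B\<close> \<open>D \<subseteq> B\<close> by (auto simp: arcs_ends_right_action_digraph)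
      then show ?thesis
        by (simp add: span_base span_scale)
    qed (simp add: span_zero)
  qed
  \<comment> \<open>The admissible \<open>v\<close> form a subspace, the preimage of
    \<open>?S\<close> under a linear map, and it contains \<open>B\<close>. The same argument in the
    left factor then finishes the proof.\<close>
  have right: "x \<star> v \<in> ?S" if "x \<in> D" for x
  proof -
    have "v \<in> span B"
      by (simp add: span_Basis)
    then show ?thesis
    proof (induction rule: span_induct)
      show "subspace {v. x \<star> v \<in> ?S}"
        using module_hom.subspace_vimage[OF module_hom_linearI[OF linear_mul_right] subspace_span]
        by (simp add: vimage_def)
    qed (use basis that in auto)
  qed
  show ?thesis
    using \<open>u \<in> span D\<close>
  proof (induction rule: span_induct)
    show "subspace {u. u \<star> v \<in> ?S}"
      using module_hom.subspace_vimage[OF module_hom_linearI[OF linear_mul_left] subspace_span]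
      by (simp add: vimage_def)
  qed (use right in auto)
qed

lemma lower_central_series_subset_span:
  "lower_central_series (Suc k) \<subseteq> span ((arcs_ends right_action_digraph ^^ k) `` B)"
proof (induction k)
  case 0
  show ?case by (simp add: span_Basis)
next
  case (Suc k)
  let ?D = "(arcs_ends right_action_digraph ^^ k) `` B"
  \<comment> \<open>For \<open>k = 0\<close> the image is \<open>B\<close> itself; otherwise it
    consists of heads of arcs, which lie in \<open>B\<close>.\<close>
  have "?D \<subseteq> B"
    by (cases k) (auto simp: arcs_ends_right_action_digraph)
  then have "u \<star> v \<in> span (arcs_ends right_action_digraph `` ?D)"
    if "u \<in> lower_central_series (Suc k)" for u v
    using mul_in_span_out_neighbours that Suc.IH by blast
  then have "subspace_mul (lower_central_series (Suc k)) UNIV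
      \<subseteq> span (arcs_ends right_action_digraph `` ?D)"
    unfolding subspace_mul_def by (intro span_minimal subspace_span) auto
  then show ?case
    by (simp add: relcomp_Image)
qed

lemma lower_central_series_eq_zero:
  assumes "\<nexists>p. wf_digraph.closed_w right_action_digraph p"
  shows "\<exists>m\<ge>1. lower_central_series m = {0}"
proof -
  interpret G: fin_digraph right_action_digraph
    by (rule fin_digraph_right_action_digraph)
  let ?R = "arcs_ends right_action_digraph"
  have "finite ?R"
    by (simp add: arcs_ends_def)
  then have "wf ?R"
    using G.acyclic_arcs_ends[OF assms] by (rule finite_acyclic_wf)
  then obtain m where "(?R ^^ m) `` B = {}"
    using wf_relpow_Image_empty[of ?R B] finite_Basis
    by (auto simp: arcs_ends_right_action_digraph)
  \<comment> \<open>The span of the empty set is \<open>{0}\<close>. The series starts at index 1,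
    so walks of length \<open>m\<close> bound the term \<open>Suc m\<close>.\<close>
  then have "lower_central_series (Suc m) = {0}"
    using lower_central_series_subset_span[of m] zero_in_lower_central_series[of "Suc m"]
    by auto
  then show ?thesis
    by (metis le_add1 plus_1_eq_Suc)
qed

end

theorem theorem4p3:
  fixes scale :: "'f::{alg_closed_field,field_char_0} \<Rightarrow> 'v::ab_group_add \<Rightarrow> 'v"
    and mul :: "'v \<Rightarrow> 'v \<Rightarrow> 'v"
    and B :: "'v set"
  assumes "nonassoc_algebra_with_basis scale mul B"
    and "\<not> (\<exists>p. wf_digraph.closed_w
                  (nonassoc_algebra_with_basis.right_action_digraph scale mul B) p)"
  shows "(\<exists>m\<ge>1. nonassoc_algebra.lower_central_series scale mul m = {0}) \<and>
    (nonassoc_algebra.leibniz mul \<longrightarrow> nonassoc_algebra.nilpotent scale mul)"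
proof -
  interpret nonassoc_algebra_with_basis scale mul B
    by (rule assms(1))
  show ?thesis
    using lower_central_series_eq_zero[OF assms(2)] by (simp add: nilpotent_def)
qed

end
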